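(* Let $\xi$ and $\xi^*$ be integrable random vectors in $\mathbb{R}^d$, neither of which is almost surely zero. Then $\xi$ and $\xi^*$ are zonoid equivalent if and only if $\mathbf{E} f(\xi)=\mathbf{E} f(\xi^* )$ for all $f\in\mathcal{H}_e$ (expectations taking values in $[0,\infty]$).
   Context: Two integrable random vectors $\xi,\xi^*$ in $\mathbb{R}^d$ (possibly defined on different probability spaces) are called zonoid equivalent if $\mathbf{E}|\langle u,\xi\rangle|=\mathbf{E}|\langle u,\xi^*\rangle|$ for all $u\in\mathbb{R}^d$. $\mathcal{H}_e$ denotes the family of all measurable functions $f:\mathbb{R}^d\to\mathbb{R}_+=[0,\infty)$ that are even ($f(-x)=f(x)$) and homogeneous, i.e. $f(cx)=cf(x)$ for all $x\in\mathbb{R}^d$ and all $c\ge 0$. *)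

theory Defs
  imports "HOL-Probability.Probability"
begin

text \<open>The two vectors may live on different probability spaces. The definition is meant for
  integrable vectors only: the Bochner integral of a non-integrable function is \<open>0\<close>.\<close>

definition zonoid_equivalent ::
  "'a measure \<Rightarrow> ('a \<Rightarrow> real ^ 'n) \<Rightarrow> 'b measure \<Rightarrow> ('b \<Rightarrow> real ^ 'n) \<Rightarrow> bool"
  where "zonoid_equivalent M X N Y \<longleftrightarrow>
    (\<forall>u. (\<integral>\<omega>. \<bar>u \<bullet> X \<omega>\<bar> \<partial>M) = (\<integral>\<omega>. \<bar>u \<bullet> Y \<omega>\<bar> \<partial>N))"

definition even_homogeneous :: "(real ^ 'n \<Rightarrow> real) set"
  where "even_homogeneous = {f. f \<in> borel_measurable borel \<and> (\<forall>x. f x \<ge> 0) \<and>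
    (\<forall>x. f (- x) = f x) \<and> (\<forall>x. \<forall>c\<ge>0. f (c *\<^sub>R x) = c * f x)}"

end

theory Submission
  imports Defs
begin

text \<open>
  Let \<open>Z\<close> be standard normal and \<open>g t = E\<bar>t + Z\<bar>\<close>. Averaging \<open>u \<mapsto> E\<bar>u \<bullet> X\<bar>\<close> over a standard Gaussian
  vector centred at \<open>v\<close> gives \<open>E (\<parallel>X\<parallel> g (v \<bullet> \<theta>))\<close> with \<open>\<theta> = X / \<parallel>X\<parallel>\<close>, by rotation invariance. The
  function \<open>g\<close> is an everywhere convergent power series whose even coefficients are all nonzero,
  so replacing \<open>v\<close> by \<open>t v\<close> and comparing coefficients in \<open>t\<close> shows that the zonoid of \<open>X\<close> determines
  the even moments \<open>E (\<parallel>X\<parallel> (v \<bullet> \<theta>)\<^sup>2\<^sup>k)\<close>, hence \<open>E (\<parallel>X\<parallel> cos (v \<bullet> \<theta>))\<close>. By Stone--Weierstrass for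
  trigonometric polynomials these determine the symmetrized law of \<open>\<theta>\<close> weighted by \<open>\<parallel>X\<parallel>\<close>, against
  which every even homogeneous function of \<open>X\<close> is integrated.
\<close>

section \<open>Real power series: uniqueness of coefficients and termwise integration\<close>

lemma powser_eq_zero_imp_coeff_zero:
  fixes d :: "nat \<Rightarrow> real"
  assumes "\<And>t. t \<noteq> 0 \<Longrightarrow> (\<lambda>k. d k * t ^ k) sums 0"
  shows "d n = 0"
  using assms
proof (induction n arbitrary: d)
  case 0
  have "((\<lambda>_. 0) \<longlongrightarrow> d 0) (at (0::real))"
    by (rule powser_limit_0_strong[of 1]) (use 0 in auto)
  then show ?case
    using tendsto_unique[OF trivial_limit_at tendsto_const] by fastforce
next
  case (Suc n)
  have "((\<lambda>_. 0) \<longlongrightarrow> d 0) (at (0::real))"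
    by (rule powser_limit_0_strong[of 1]) (use Suc.prems in auto)
  then have d0: "d 0 = 0"
    using tendsto_unique[OF trivial_limit_at tendsto_const] by fastforce
  \<comment> \<open>Dividing by \<open>t\<close> lowers every exponent by one. This works only away
    from 0, so the hypothesis is restricted to \<open>t \<noteq> 0\<close> and the constant term is
    read off as a limit.\<close>
  have "(\<lambda>k. d (Suc k) * t ^ k) sums 0" if "t \<noteq> 0" for t
  proof -
    have "(\<lambda>k. d (Suc k) * t ^ Suc k) sums 0"
      using Suc.prems[OF that] d0 by (subst sums_Suc_iff) simp
    from sums_mult[OF this, of "inverse t"] show ?thesis
      using that by (simp add: field_simps)
  qed
  then show ?case
    by (rule Suc.IH)
qed

lemma powser_unique:
  fixes a b :: "nat \<Rightarrow> real"
  assumes "\<And>t. (\<lambda>k. a k * t ^ k) sums F t" "\<And>t. (\<lambda>k. b k * t ^ k) sums F t"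
  shows "a k = b k"
proof -
  have "(\<lambda>k. (a k - b k) * t ^ k) sums 0" for t
    using sums_diff[OF assms(1)[of t] assms(2)[of t]] by (simp add: algebra_simps)
  from powser_eq_zero_imp_coeff_zero[OF this, of k] show ?thesis
    by simp
qed

text \<open>The series converges everywhere, hence absolutely at \<open>R\<close>, so
  \<open>\<bar>a k\<bar> * \<bar>R\<bar> ^ k\<close> times the integral of
  \<open>\<bar>W x\<bar>\<close> is a summable majorant, and sum and integral may be exchanged. The
  bound on \<open>T\<close> is asked only where \<open>W\<close> is nonzero, so that a compactly
  supported weight on the whole line qualifies.\<close>

lemma
  fixes W T :: "'a \<Rightarrow> real" and a :: "nat \<Rightarrow> real"
  assumes W: "integrable M W" and T[measurable]: "T \<in> borel_measurable M"
    and bound: "\<And>x. W x \<noteq> 0 \<Longrightarrow> \<bar>T x\<bar> \<le> R"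
    and F: "\<And>t. (\<lambda>k. a k * t ^ k) sums F t"
  shows integrable_weighted_power: "integrable M (\<lambda>x. W x * T x ^ k)"
    and weighted_powser_sums: "(\<lambda>k. a k * (\<integral>x. W x * T x ^ k \<partial>M)) sums (\<integral>x. W x * F (T x) \<partial>M)"
proof -
  have [measurable]: "W \<in> borel_measurable M" using W by auto
  have b: "\<bar>W x * T x ^ k\<bar> \<le> \<bar>R\<bar> ^ k * \<bar>W x\<bar>" for x k
  proof (cases "W x = 0")
    case False
    then have "\<bar>T x\<bar> ^ k \<le> \<bar>R\<bar> ^ k"
      using bound[OF False] by (intro power_mono) auto
    then show ?thesis
      by (simp add: abs_mult power_abs mult.commute[of "\<bar>W x\<bar>"] mult_right_mono)
  qed simp
  show int: "integrable M (\<lambda>x. W x * T x ^ k)" for k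
  proof (rule Bochner_Integration.integrable_bound)
    show "integrable M (\<lambda>x. \<bar>R\<bar> ^ k * \<bar>W x\<bar>)"
      using W by simp
  qed (use b in auto)
  have absS: "summable (\<lambda>k. \<bar>a k\<bar> * \<bar>t\<bar> ^ k)" for t :: real
  proof -
    \<comment> \<open>Convergence at the larger point \<open>\<bar>t\<bar> + 1\<close> gives
      absolute convergence at \<open>t\<close>.\<close>
    have "summable (\<lambda>k. norm (a k * t ^ k))"
      by (rule powser_insidea[of _ "\<bar>t\<bar> + 1"]) (use F[THEN sums_summable] in auto)
    then show ?thesis by (simp add: abs_mult power_abs)
  qed
  define f where "f k x = a k * (W x * T x ^ k)" for k x
  have sums_f: "(\<lambda>k. f k x) sums (W x * F (T x))" for x
    using sums_mult[OF F[of "T x"], of "W x"] by (simp add: f_def mult.left_commute)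
  have "(\<lambda>k. integral\<^sup>L M (f k)) sums (\<integral>x. (\<Sum>k. f k x) \<partial>M)"
  proof (rule sums_integral)
    show "integrable M (f k)" for k
      unfolding f_def using int by simp
    have "summable (\<lambda>k. norm (f k x))" for x
      using summable_mult[OF absS[of "T x"], of "\<bar>W x\<bar>"]
      by (simp add: f_def abs_mult power_abs mult.left_commute)
    then show "AE x in M. summable (\<lambda>k. norm (f k x))" by simp
    show "summable (\<lambda>k. \<integral>x. norm (f k x) \<partial>M)"
    proof (rule summable_comparison_test')
      show "summable (\<lambda>k. (\<bar>a k\<bar> * \<bar>R\<bar> ^ k) * (\<integral>x. \<bar>W x\<bar> \<partial>M))"
        by (intro summable_mult2 absS)
      fix k
      have "(\<integral>x. norm (f k x) \<partial>M) \<le> (\<integral>x. \<bar>a k\<bar> * (\<bar>R\<bar> ^ k * \<bar>W x\<bar>) \<partial>M)"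
      proof (rule integral_mono)
        show "integrable M (\<lambda>x. norm (f k x))"
          unfolding f_def using int by simp
        show "integrable M (\<lambda>x. \<bar>a k\<bar> * (\<bar>R\<bar> ^ k * \<bar>W x\<bar>))"
          using W by simp
        show "norm (f k x) \<le> \<bar>a k\<bar> * (\<bar>R\<bar> ^ k * \<bar>W x\<bar>)" for x
          using b[of x k] by (simp add: f_def abs_mult mult_left_mono)
      qed
      then show "norm (\<integral>x. norm (f k x) \<partial>M) \<le> (\<bar>a k\<bar> * \<bar>R\<bar> ^ k) * (\<integral>x. \<bar>W x\<bar> \<partial>M)"
        by (simp add: mult.assoc)
    qed
  qed
  moreover have "(\<lambda>k. integral\<^sup>L M (f k)) = (\<lambda>k. a k * (\<integral>x. W x * T x ^ k \<partial>M))"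
    by (simp add: f_def[abs_def])
  ultimately show "(\<lambda>k. a k * (\<integral>x. W x * T x ^ k \<partial>M)) sums (\<integral>x. W x * F (T x) \<partial>M)"
    using sums_f by (simp add: sums_iff)
qed

section \<open>The Gaussian average of \<open>\<bar>t + z\<bar>\<close> and its power series\<close>

definition gauss_abs :: "real \<Rightarrow> real"
  where "gauss_abs t = (\<integral>z. std_normal_density z * \<bar>t + z\<bar> \<partial>lborel)"

lemma integrable_std_normal_abs_shift:
  "integrable lborel (\<lambda>z. std_normal_density z * \<bar>t + z\<bar>)"
proof (rule Bochner_Integration.integrable_bound)
  show "integrable lborel (\<lambda>z. std_normal_density z * \<bar>t\<bar> + std_normal_density z * \<bar>z\<bar> ^ 1)"
    by (intro Bochner_Integration.integrable_add integrable_std_normal_moment_abs integrable_mult_left) simp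
qed (auto simp: abs_mult simp flip: distrib_left intro!: mult_left_mono)

text \<open>By symmetry of the normal law, \<open>\<bar>t + z\<bar>\<close> may be replaced by
  \<open>(\<bar>t + z\<bar> + \<bar>t - z\<bar>) / 2\<close>, the maximum of
  \<open>\<bar>t\<bar>\<close> and \<open>\<bar>z\<bar>\<close>, which is
  \<open>\<bar>z\<bar> + max 0 (\<bar>t\<bar> - \<bar>z\<bar>)\<close>. Rescaling turns the last
  term into an integral against a fixed tent, where the density can be expanded in powers of
  \<open>t\<close> because the tent has bounded support.\<close>

lemma gauss_abs_eq:
  "gauss_abs t = (\<integral>z. std_normal_density z * \<bar>z\<bar> \<partial>lborel)
     + t ^ 2 * (\<integral>s. max 0 (1 - \<bar>s\<bar>) * std_normal_density (t * s) \<partial>lborel)"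
proof (cases "t = 0")
  case False
  let ?\<phi> = "std_normal_density"
  have minus: "gauss_abs t = (\<integral>z. ?\<phi> z * \<bar>t - z\<bar> \<partial>lborel)"
    unfolding gauss_abs_def by (subst lborel_integral_real_affine[of "-1" _ 0]) (auto simp: normal_density_def)
  have im: "integrable lborel (\<lambda>z. ?\<phi> z * \<bar>t - z\<bar>)"
    using lborel_integrable_real_affine[OF integrable_std_normal_abs_shift[of t], of "-1" 0]
    by (simp add: normal_density_def)
  have i0: "integrable lborel (\<lambda>z. ?\<phi> z * \<bar>z\<bar>)"
    using integrable_std_normal_abs_shift[of 0] by simp
  have split: "?\<phi> z * max 0 (\<bar>t\<bar> - \<bar>z\<bar>)
      = (?\<phi> z * \<bar>t + z\<bar> + ?\<phi> z * \<bar>t - z\<bar>) / 2 - ?\<phi> z * \<bar>z\<bar>" for z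
  proof -
    have "max 0 (\<bar>t\<bar> - \<bar>z\<bar>) = (\<bar>t + z\<bar> + \<bar>t - z\<bar>) / 2 - \<bar>z\<bar>"
      by (auto simp: abs_if max_def field_simps)
    then show ?thesis by (simp only: ring_distribs add_divide_distrib times_divide_eq_right)
  qed
  have "(\<integral>z. ?\<phi> z * max 0 (\<bar>t\<bar> - \<bar>z\<bar>) \<partial>lborel) = gauss_abs t - (\<integral>z. ?\<phi> z * \<bar>z\<bar> \<partial>lborel)"
    unfolding split using im i0 integrable_std_normal_abs_shift[of t]
    by (subst Bochner_Integration.integral_diff) (auto simp: gauss_abs_def[symmetric] minus[symmetric])
  \<comment> \<open>The substitution \<open>z = t * s\<close>, valid for
    \<open>t \<noteq> 0\<close>, contributes one factor \<open>\<bar>t\<bar>\<close>; the scaling of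
    the tent contributes the second.\<close>
  moreover have "(\<integral>z. ?\<phi> z * max 0 (\<bar>t\<bar> - \<bar>z\<bar>) \<partial>lborel)
      = \<bar>t\<bar> * (\<integral>s. ?\<phi> (t * s) * max 0 (\<bar>t\<bar> - \<bar>t * s\<bar>) \<partial>lborel)"
    by (subst lborel_integral_real_affine[of t _ 0]) (use False in auto)
  moreover have "max 0 (\<bar>t\<bar> - \<bar>t * s\<bar>) = \<bar>t\<bar> * max 0 (1 - \<bar>s\<bar>)" for s
    by (subst max_mult_distrib_left) (simp add: abs_mult algebra_simps)
  ultimately show ?thesis
    by (simp add: power2_eq_square mult.commute mult.left_commute)
qed (simp add: gauss_abs_def)

lemma std_normal_density_powser:
  obtains a :: "nat \<Rightarrow> real"
  where "\<And>x. (\<lambda>k. a k * x ^ k) sums std_normal_density x" "\<And>k. even k \<Longrightarrow> a k \<noteq> 0"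
proof
  define a :: "nat \<Rightarrow> real" where
    "a k = (if even k then (-1/2) ^ (k div 2) / fact (k div 2) / sqrt (2 * pi) else 0)" for k
  show "even k \<Longrightarrow> a k \<noteq> 0" for k by (simp add: a_def)
  fix x :: real
  have "(\<lambda>n. (- x\<^sup>2 / 2) ^ n /\<^sub>R fact n) sums exp (- x\<^sup>2 / 2)"
    by (rule exp_converges)
  from sums_divide[OF this, of "sqrt (2 * pi)"]
  have "(\<lambda>n. (- x\<^sup>2 / 2) ^ n /\<^sub>R fact n / sqrt (2 * pi)) sums std_normal_density x"
    by (simp add: std_normal_density_def)
  moreover have "(- x\<^sup>2 / 2) ^ n /\<^sub>R fact n / sqrt (2 * pi) = a (2 * n) * x ^ (2 * n)" for n
  proof -
    have "- x\<^sup>2 / 2 = (-1/2) * x\<^sup>2" by simp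
    then have "(- x\<^sup>2 / 2) ^ n = (-1/2) ^ n * x ^ (2 * n)"
      by (simp only: power_mult power_mult_distrib)
    moreover have "a (2 * n) = (-1/2) ^ n / fact n / sqrt (2 * pi)"
      by (simp add: a_def)
    ultimately show ?thesis by (simp only: real_scaleR_def divide_inverse mult_ac)
  qed
  ultimately have "(\<lambda>n. a (2 * n) * x ^ (2 * n)) sums std_normal_density x"
    by simp
  \<comment> \<open>The odd terms vanish, so the series over the exponents \<open>2 * n\<close>
    reindexes to the full one.\<close>
  moreover have "a k * x ^ k = 0" if "k \<notin> range (\<lambda>n. 2 * n)" for k
    using that by (auto simp: a_def)
  ultimately show "(\<lambda>k. a k * x ^ k) sums std_normal_density x"
    by (subst (asm) sums_mono_reindex[of "\<lambda>n. 2 * n" "\<lambda>k. a k * x ^ k"]) (simp_all add: strict_mono_def)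
qed

lemma integrable_tent: "integrable lborel (\<lambda>s::real. max 0 (1 - \<bar>s\<bar>))"
proof (rule Bochner_Integration.integrable_bound)
  show "integrable lborel (indicator {-1..1} :: real \<Rightarrow> real)"
    by (simp add: integrable_indicator_iff)
qed (auto simp: indicator_def)

text \<open>For even \<open>k\<close> the integrand is nonnegative, and on \<open>{1/4..1/2}\<close>
  the tent is at least 1/2 and the power at least \<open>(1/4) ^ k\<close>.\<close>

lemma tent_moment_pos:
  assumes "even k"
  shows "0 < (\<integral>s. max 0 (1 - \<bar>s::real\<bar>) * s ^ k \<partial>lborel)"
proof -
  have "0 < (\<integral>s. 1/2 * (1/4) ^ k * indicator {1/4..1/2::real} s \<partial>lborel :: real)"
    by simp
  also have "\<dots> \<le> (\<integral>s. max 0 (1 - \<bar>s::real\<bar>) * s ^ k \<partial>lborel)"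
  proof (rule integral_mono)
    show "integrable lborel (\<lambda>s::real. max 0 (1 - \<bar>s\<bar>) * s ^ k)"
      \<comment> \<open>The tent vanishes outside [-1, 1], hence \<open>R = 1\<close>; the zero
        series instantiates the hypothesis on power series.\<close>
      by (rule integrable_weighted_power[OF integrable_tent, where R = 1 and a = "\<lambda>_. 0" and F = "\<lambda>_. 0"])
        (auto simp: max_def split: if_splits)
    fix s :: real
    show "1/2 * (1/4) ^ k * indicator {1/4..1/2} s \<le> max 0 (1 - \<bar>s\<bar>) * s ^ k"
    proof (cases "s \<in> {1/4..1/2}")
      case True
      then have "1/2 * (1/4) ^ k \<le> max 0 (1 - \<bar>s\<bar>) * s ^ k"
        by (intro mult_mono power_mono) auto
      with True show ?thesis by simp
    qed (use assms in \<open>simp add: zero_le_even_power\<close>)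
  qed (simp add: integrable_indicator_iff)
  finally show ?thesis .
qed

lemma gauss_abs_powser:
  obtains c :: "nat \<Rightarrow> real"
  where "\<And>t. (\<lambda>k. c k * t ^ k) sums gauss_abs t" "\<And>k. even k \<Longrightarrow> c k \<noteq> 0"
proof -
  obtain a :: "nat \<Rightarrow> real"
    where a: "\<And>x. (\<lambda>k. a k * x ^ k) sums std_normal_density x" "\<And>k. even k \<Longrightarrow> a k \<noteq> 0"
    using std_normal_density_powser by blast
  define b where "b k = (\<integral>s. max 0 (1 - \<bar>s::real\<bar>) * s ^ k \<partial>lborel)" for k :: nat
  define z where "z = (\<integral>z. std_normal_density z * \<bar>z\<bar> \<partial>lborel)"
  have z: "z \<noteq> 0"
    using integral_std_normal_moment_abs_odd[of 0] by (simp add: z_def)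
  \<comment> \<open>The constant term is the mean of \<open>\<bar>z\<bar>\<close>. The factor
    \<open>t ^ 2\<close> in \<open>gauss_abs_eq\<close> moves the coefficients of the tent integral
    up by two and leaves no linear term.\<close>
  define c where "c k = (if k = 0 then z else if k = 1 then 0 else a (k - 2) * b (k - 2))" for k
  show thesis
  proof (rule that)
    show "c k \<noteq> 0" if "even k" for k
      using that z a(2)[of "k - 2"] tent_moment_pos[of "k - 2"]
      by (auto simp: c_def b_def)
    fix t :: real
    have "(\<lambda>k. a k * (\<integral>s. max 0 (1 - \<bar>s\<bar>) * (t * s) ^ k \<partial>lborel))
        sums (\<integral>s. max 0 (1 - \<bar>s\<bar>) * std_normal_density (t * s) \<partial>lborel)"
    proof (rule weighted_powser_sums[OF integrable_tent _ _ a(1), where R = "\<bar>t\<bar>"])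
      show "\<bar>t * s\<bar> \<le> \<bar>t\<bar>" if "max 0 (1 - \<bar>s\<bar>) \<noteq> 0" for s
        using that by (auto simp: abs_mult max_def mult_left_le split: if_splits)
    qed simp
    then have "(\<lambda>k. a k * t ^ k * b k) sums (\<integral>s. max 0 (1 - \<bar>s\<bar>) * std_normal_density (t * s) \<partial>lborel)"
      by (simp add: b_def power_mult_distrib mult.left_commute mult.assoc)
    from sums_mult[OF this, of "t ^ 2"]
    have "(\<lambda>k. c (Suc (Suc k)) * t ^ Suc (Suc k)) sums (gauss_abs t - z)"
      by (simp add: c_def gauss_abs_eq z_def power2_eq_square mult.left_commute mult.assoc mult.commute)
    \<comment> \<open>Undoing the shift by two adds back \<open>c 0 = z\<close> and the linear term
      0.\<close>
    then show "(\<lambda>k. c k * t ^ k) sums gauss_abs t"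
      by (subst (asm) sums_Suc_iff, subst (asm) sums_Suc_iff) (simp add: c_def)
  qed
qed

section \<open>The standard Gaussian vector\<close>

text \<open>A law on families of coordinates rather than on vectors, so that independence comes from
  the product construction. The Gaussian vector itself is
  \<open>\<Sum>b\<in>Basis. \<omega> b *\<^sub>R b\<close>.\<close>

definition std_gaussian :: "('b::euclidean_space \<Rightarrow> real) measure"
  where "std_gaussian = (\<Pi>\<^sub>M b\<in>Basis. density lborel std_normal_density)"

lemma prob_space_std_normal: "prob_space (density lborel std_normal_density)"
  by (rule prob_space_normal_density) simp

lemma prob_space_std_gaussian: "prob_space std_gaussian"
  unfolding std_gaussian_def by (rule prob_space_PiM) (rule prob_space_std_normal)

lemma measurable_std_gaussian_component [measurable]:
  "b \<in> Basis \<Longrightarrow> (\<lambda>\<omega>. \<omega> b) \<in> borel_measurable std_gaussian"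
  unfolding std_gaussian_def by measurable

lemma distributed_std_gaussian_component:
  assumes "b \<in> Basis"
  shows "distributed std_gaussian lborel (\<lambda>\<omega>. \<omega> b) std_normal_density"
proof -
  have "distr std_gaussian lborel (\<lambda>\<omega>. \<omega> b)
      = distr std_gaussian (density lborel std_normal_density) (\<lambda>\<omega>. \<omega> b)"
    by (rule distr_cong) auto
  also have "\<dots> = density lborel std_normal_density"
    unfolding std_gaussian_def by (rule distr_PiM_component) (use assms prob_space_std_normal in auto)
  finally show ?thesis
    using assms by (simp add: distributed_def)
qed

text \<open>Independence means that the joint law is the product of the marginals, and
  \<open>std_gaussian\<close> is built as that product.\<close>

lemma indep_std_gaussian:
  "prob_space.indep_vars (std_gaussian :: ('b::euclidean_space \<Rightarrow> real) measure)
     (\<lambda>_. borel) (\<lambda>b \<omega>. \<omega> b) Basis"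
proof -
  interpret prob_space "std_gaussian :: ('b \<Rightarrow> real) measure" by (rule prob_space_std_gaussian)
  have sets: "sets (std_gaussian :: ('b \<Rightarrow> real) measure) = sets (\<Pi>\<^sub>M b\<in>Basis. borel)"
    unfolding std_gaussian_def by (intro sets_PiM_cong) auto
  have "distr std_gaussian (\<Pi>\<^sub>M b\<in>Basis. borel) (\<lambda>x. \<lambda>b\<in>Basis. x b)
      = distr std_gaussian (std_gaussian :: ('b \<Rightarrow> real) measure) (\<lambda>x. x)"
  proof (rule distr_cong[OF refl])
    \<comment> \<open>Points of the product space are extensional, so restriction to
      \<open>Basis\<close> is the identity.\<close>
    show "(\<lambda>b\<in>Basis. \<omega> b) = \<omega>" if "\<omega> \<in> space std_gaussian" for \<omega> :: "'b \<Rightarrow> real"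
      using that by (auto simp: std_gaussian_def space_PiM)
  qed (simp add: sets)
  also have "\<dots> = (\<Pi>\<^sub>M b\<in>Basis. density lborel std_normal_density)"
    by (simp add: std_gaussian_def)
  also have "\<dots> = (\<Pi>\<^sub>M b\<in>Basis. distr std_gaussian borel (\<lambda>\<omega>. \<omega> b))"
  proof (rule PiM_cong)
    fix b :: 'b assume "b \<in> Basis"
    then show "density lborel std_normal_density = distr std_gaussian borel (\<lambda>\<omega>. \<omega> b)"
      using distributed_distr_eq_density[OF distributed_std_gaussian_component]
      by (metis distr_cong sets_lborel)
  qed simp
  finally show ?thesis
    by (subst indep_vars_iff_distr_eq_PiM') auto
qed

text \<open>Rotation invariance in one-dimensional form: the variances of the independent normal
  summands add up to the square of \<open>norm e\<close>, which is 1.\<close>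

lemma distributed_std_gaussian_linear:
  fixes e :: "'b::euclidean_space"
  assumes "norm e = 1"
  shows "distributed std_gaussian lborel (\<lambda>\<omega>. \<Sum>b\<in>Basis. (e \<bullet> b) * \<omega> b) std_normal_density"
proof -
  interpret prob_space "std_gaussian :: ('b \<Rightarrow> real) measure" by (rule prob_space_std_gaussian)
  \<comment> \<open>Coordinates with coefficient 0 are dropped, because a constant has no normal
    density.\<close>
  define J where "J = {b \<in> Basis. e \<bullet> b \<noteq> 0}"
  have J: "J \<subseteq> Basis" "finite J" by (auto simp: J_def)
  have "e \<noteq> 0" using assms by auto
  then have ne: "J \<noteq> {}" using euclidean_all_zero_iff[of e] by (auto simp: J_def)
  \<comment> \<open>The added \<open>0\<close> gives the summands the affine shape of
    \<open>normal_density_affine\<close>.\<close>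
  have eq: "(\<Sum>b\<in>Basis. (e \<bullet> b) * \<omega> b) = (\<Sum>b\<in>J. 0 + (e \<bullet> b) * \<omega> b)" for \<omega>
    unfolding J_def by (intro sum.mono_neutral_cong_right) auto
  have "(\<Sum>b\<in>J. (\<bar>e \<bullet> b\<bar> * 1)\<^sup>2) = (\<Sum>b\<in>Basis. (e \<bullet> b)\<^sup>2)"
    unfolding J_def by (intro sum.mono_neutral_cong_left) auto
  also have "\<dots> = e \<bullet> e"
    by (simp only: euclidean_inner[of e e] power2_eq_square)
  also have "\<dots> = 1"
    using assms by (simp add: dot_square_norm)
  finally have one: "(\<Sum>b\<in>J. (\<bar>e \<bullet> b\<bar> * 1)\<^sup>2) = 1" .
  have "distributed std_gaussian lborel (\<lambda>\<omega>. \<Sum>b\<in>J. 0 + (e \<bullet> b) * \<omega> b)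
      (normal_density (\<Sum>b\<in>J. 0 + (e \<bullet> b) * 0) (sqrt (\<Sum>b\<in>J. (\<bar>e \<bullet> b\<bar> * 1)\<^sup>2)))"
  proof (rule sum_indep_normal[OF J(2) ne])
    show "indep_vars (\<lambda>_. borel) (\<lambda>b \<omega>. 0 + (e \<bullet> b) * \<omega> b) J"
      by (rule indep_vars_compose2[OF indep_vars_subset[OF indep_std_gaussian J(1)]]) auto
    fix b assume b: "b \<in> J"
    then show "0 < \<bar>e \<bullet> b\<bar> * 1" by (simp add: J_def)
    show "distributed std_gaussian lborel (\<lambda>\<omega>. 0 + (e \<bullet> b) * \<omega> b)
        (normal_density (0 + (e \<bullet> b) * 0) (\<bar>e \<bullet> b\<bar> * 1))"
      by (rule normal_density_affine[OF distributed_std_gaussian_component]) (use b J in \<open>auto simp: J_def\<close>)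
  qed
  then show ?thesis
    by (simp add: eq one[simplified])
qed

text \<open>The inner product is \<open>norm x\<close> times the sum of
  \<open>v \<bullet> sgn x\<close> and the component of the Gaussian vector along the unit vector
  \<open>sgn x\<close>, which is standard normal. For \<open>x = 0\<close> both sides
  vanish.\<close>

lemma nn_integral_std_gaussian_abs_inner:
  fixes v x :: "'b::euclidean_space"
  shows "(\<integral>\<^sup>+\<omega>. ennreal \<bar>(v + (\<Sum>b\<in>Basis. \<omega> b *\<^sub>R b)) \<bullet> x\<bar> \<partial>std_gaussian)
    = ennreal (norm x * gauss_abs (v \<bullet> sgn x))"
proof (cases "x = 0")
  case False
  let ?Z = "\<lambda>\<omega>::'b \<Rightarrow> real. \<Sum>b\<in>Basis. (sgn x \<bullet> b) * \<omega> b"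
  have dist: "distributed std_gaussian lborel ?Z std_normal_density"
    using False by (intro distributed_std_gaussian_linear) (simp add: norm_sgn)
  have "(v + (\<Sum>b\<in>Basis. \<omega> b *\<^sub>R b)) \<bullet> x = norm x * (v \<bullet> sgn x + ?Z \<omega>)" for \<omega>
    using False
    by (simp add: sgn_div_norm inner_add_left inner_sum_left inner_commute[of x] sum_distrib_left field_simps)
  then have eq: "\<bar>(v + (\<Sum>b\<in>Basis. \<omega> b *\<^sub>R b)) \<bullet> x\<bar> = norm x * \<bar>v \<bullet> sgn x + ?Z \<omega>\<bar>" for \<omega>
    by (simp add: abs_mult)
  have "integrable std_gaussian (\<lambda>\<omega>. \<bar>v \<bullet> sgn x + ?Z \<omega>\<bar>)"
    by (subst distributed_integrable[OF dist, symmetric]) (use integrable_std_normal_abs_shift in auto)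
  moreover have "(\<integral>\<omega>. \<bar>v \<bullet> sgn x + ?Z \<omega>\<bar> \<partial>std_gaussian) = gauss_abs (v \<bullet> sgn x)"
    unfolding gauss_abs_def by (subst distributed_integral[OF dist, symmetric]) auto
  ultimately show ?thesis
    unfolding eq by (subst nn_integral_eq_integral) auto
qed simp

section \<open>From the zonoid to cosine integrals over directions\<close>

lemma measurable_gauss_abs [measurable]: "gauss_abs \<in> borel_measurable borel"
  unfolding gauss_abs_def by measurable

lemma gauss_abs_nonneg: "0 \<le> gauss_abs t"
  unfolding gauss_abs_def by (intro Bochner_Integration.integral_nonneg) auto

text \<open>Tonelli's theorem. The right-hand side involves \<open>X\<close> only through the means
  of \<open>\<bar>u \<bullet> X x\<bar>\<close>, so zonoid equivalent vectors share the left-hand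
  side.\<close>

lemma nn_integral_gauss_abs_inner:
  fixes X :: "'a \<Rightarrow> 'b::euclidean_space"
  assumes "prob_space M" and X: "integrable M X"
  shows "(\<integral>\<^sup>+x. ennreal (norm (X x) * gauss_abs (v \<bullet> sgn (X x))) \<partial>M)
    = (\<integral>\<^sup>+\<omega>. ennreal (\<integral>x. \<bar>(v + (\<Sum>b\<in>Basis. \<omega> b *\<^sub>R b)) \<bullet> X x\<bar> \<partial>M) \<partial>std_gaussian)"
proof -
  interpret M: prob_space M by fact
  interpret G: prob_space "std_gaussian :: ('b \<Rightarrow> real) measure" by (rule prob_space_std_gaussian)
  interpret pair_sigma_finite "std_gaussian :: ('b \<Rightarrow> real) measure" M ..
  have [measurable]: "X \<in> borel_measurable M" using X by auto
  have "(\<integral>\<^sup>+x. ennreal (norm (X x) * gauss_abs (v \<bullet> sgn (X x))) \<partial>M)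
      = (\<integral>\<^sup>+x. \<integral>\<^sup>+\<omega>. ennreal \<bar>(v + (\<Sum>b\<in>Basis. \<omega> b *\<^sub>R b)) \<bullet> X x\<bar> \<partial>std_gaussian \<partial>M)"
    by (simp add: nn_integral_std_gaussian_abs_inner)
  also have "\<dots> = (\<integral>\<^sup>+\<omega>. \<integral>\<^sup>+x. ennreal \<bar>(v + (\<Sum>b\<in>Basis. \<omega> b *\<^sub>R b)) \<bullet> X x\<bar> \<partial>M \<partial>std_gaussian)"
    by (rule Fubini') measurable
  also have "\<dots> = (\<integral>\<^sup>+\<omega>. ennreal (\<integral>x. \<bar>(v + (\<Sum>b\<in>Basis. \<omega> b *\<^sub>R b)) \<bullet> X x\<bar> \<partial>M) \<partial>std_gaussian)"
    by (intro nn_integral_cong nn_integral_eq_integral integrable_abs integrable_inner_right) (use X in auto)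
  finally show ?thesis .
qed

text \<open>The even moments of \<open>v \<bullet> sgn (X x)\<close> weighted by
  \<open>norm (X x)\<close> can be recovered, since the even coefficients of
  \<open>gauss_abs\<close> are nonzero; the cosine series uses no others.\<close>

lemma integral_cos_sgn_eq:
  fixes X :: "'a \<Rightarrow> 'c::euclidean_space" and Y :: "'b \<Rightarrow> 'c"
  assumes "prob_space M" "prob_space N" and X: "integrable M X" and Y: "integrable N Y"
    and eq: "\<And>u. (\<integral>x. \<bar>u \<bullet> X x\<bar> \<partial>M) = (\<integral>y. \<bar>u \<bullet> Y y\<bar> \<partial>N)"
  shows "(\<integral>x. norm (X x) * cos (v \<bullet> sgn (X x)) \<partial>M) = (\<integral>y. norm (Y y) * cos (v \<bullet> sgn (Y y)) \<partial>N)"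
proof -
  have [measurable]: "X \<in> borel_measurable M" "Y \<in> borel_measurable N" using X Y by auto
  obtain c :: "nat \<Rightarrow> real"
    where c: "\<And>t. (\<lambda>k. c k * t ^ k) sums gauss_abs t" "\<And>k. even k \<Longrightarrow> c k \<noteq> 0"
    using gauss_abs_powser by blast
  have bnd: "\<bar>v \<bullet> sgn x\<bar> \<le> norm v" for v x :: 'c
    using Cauchy_Schwarz_ineq2[of v "sgn x"] by (auto simp: norm_sgn split: if_splits)
  have smooth: "(\<integral>x. norm (X x) * gauss_abs (v \<bullet> sgn (X x)) \<partial>M)
      = (\<integral>y. norm (Y y) * gauss_abs (v \<bullet> sgn (Y y)) \<partial>N)" for v
    using nn_integral_gauss_abs_inner[OF assms(1) X, of v] nn_integral_gauss_abs_inner[OF assms(2) Y, of v]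
    by (subst (1 2) integral_eq_nn_integral) (auto simp: gauss_abs_nonneg eq)
  \<comment> \<open>Scaling \<open>v\<close> by \<open>t\<close> exposes the moments as coefficients
    of a power series in \<open>t\<close>. The general \<open>L\<close> and \<open>Z\<close> serve
    both vectors.\<close>
  have moments: "(\<lambda>k. (c k * (\<integral>x. norm (Z x) * (v \<bullet> sgn (Z x)) ^ k \<partial>L)) * t ^ k)
      sums (\<integral>x. norm (Z x) * gauss_abs ((t *\<^sub>R v) \<bullet> sgn (Z x)) \<partial>L)"
    if Z: "integrable L Z" for L :: "'d measure" and Z :: "'d \<Rightarrow> 'c" and t
  proof -
    have [measurable]: "Z \<in> borel_measurable L" using Z by auto
    have "(\<lambda>k. c k * (\<integral>x. norm (Z x) * ((t *\<^sub>R v) \<bullet> sgn (Z x)) ^ k \<partial>L))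
        sums (\<integral>x. norm (Z x) * gauss_abs ((t *\<^sub>R v) \<bullet> sgn (Z x)) \<partial>L)"
      by (rule weighted_powser_sums[OF _ _ bnd c(1)]) (use Z in auto)
    then show ?thesis
      by (simp add: power_mult_distrib mult.left_commute mult.assoc mult.commute[of _ "t ^ _"])
  qed
  \<comment> \<open>Folding \<open>smooth\<close> gives the two series the same sum.\<close>
  have "c k * (\<integral>x. norm (X x) * (v \<bullet> sgn (X x)) ^ k \<partial>M) = c k * (\<integral>y. norm (Y y) * (v \<bullet> sgn (Y y)) ^ k \<partial>N)" for k
    by (rule powser_unique[OF moments[OF X] moments[OF Y, folded smooth]])
  \<comment> \<open>For odd \<open>k\<close> both sides are 0 because
    \<open>cos_coeff k = 0\<close>; for even \<open>k\<close> the factor \<open>c k\<close>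
    cancels.\<close>
  then have coeff: "cos_coeff k * (\<integral>x. norm (X x) * (v \<bullet> sgn (X x)) ^ k \<partial>M)
      = cos_coeff k * (\<integral>y. norm (Y y) * (v \<bullet> sgn (Y y)) ^ k \<partial>N)" for k
    using c(2)[of k] by (cases "even k") (auto simp: cos_coeff_def)
  have cos_sums: "(\<lambda>k. cos_coeff k * (\<integral>x. norm (Z x) * (v \<bullet> sgn (Z x)) ^ k \<partial>L))
      sums (\<integral>x. norm (Z x) * cos (v \<bullet> sgn (Z x)) \<partial>L)"
    if Z: "integrable L Z" for L :: "'d measure" and Z :: "'d \<Rightarrow> 'c"
  proof -
    have [measurable]: "Z \<in> borel_measurable L" using Z by auto
    show ?thesis
      by (rule weighted_powser_sums[OF _ _ bnd]) (use Z cos_converges[where ?'a = real, unfolded real_scaleR_def] in auto)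
  qed
  show ?thesis
    by (rule sums_unique2[OF cos_sums[OF X, unfolded coeff] cos_sums[OF Y]])
qed


section \<open>Trigonometric polynomials and their density\<close>

text \<open>Products are not a generating rule, so that comparing integrals by induction needs only
  additivity. Closure under products, which Stone-Weierstrass requires, is derived.\<close>

inductive trig_poly :: "('b::real_inner \<Rightarrow> real) \<Rightarrow> bool" where
  cos: "trig_poly (\<lambda>x. a * cos (v \<bullet> x))"
| sin: "trig_poly (\<lambda>x. a * sin (v \<bullet> x))"
| add: "trig_poly p \<Longrightarrow> trig_poly q \<Longrightarrow> trig_poly (\<lambda>x. p x + q x)"

lemma trig_poly_const: "trig_poly (\<lambda>_. c)"
  using trig_poly.cos[of c 0] by simp

text \<open>The product-to-sum formulas replace the frequencies \<open>v\<close> and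
  \<open>w\<close> by \<open>v - w\<close> and \<open>v + w\<close>;
  \<open>trig_poly_mult_sin\<close> is the companion case.\<close>

lemma trig_poly_mult_cos:
  assumes "trig_poly p" shows "trig_poly (\<lambda>x. (a * cos (v \<bullet> x)) * p x)"
  using assms
proof induction
  case (cos b w)
  have "(\<lambda>x. (a * cos (v \<bullet> x)) * (b * cos (w \<bullet> x)))
      = (\<lambda>x. a * b / 2 * cos ((v - w) \<bullet> x) + a * b / 2 * cos ((v + w) \<bullet> x))"
    by (simp add: fun_eq_iff cos_add cos_diff algebra_simps)
  then show ?case by (simp only: trig_poly.intros)
next
  case (sin b w)
  have "(\<lambda>x. (a * cos (v \<bullet> x)) * (b * sin (w \<bullet> x)))
      = (\<lambda>x. a * b / 2 * sin ((v + w) \<bullet> x) + (- (a * b / 2)) * sin ((v - w) \<bullet> x))"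
    by (simp add: fun_eq_iff sin_add sin_diff algebra_simps)
  then show ?case by (simp only: trig_poly.intros)
next
  case (add p q)
  then show ?case by (simp add: distrib_left trig_poly.add)
qed

lemma trig_poly_mult_sin:
  assumes "trig_poly p" shows "trig_poly (\<lambda>x. (a * sin (v \<bullet> x)) * p x)"
  using assms
proof induction
  case (cos b w)
  have "(\<lambda>x. (a * sin (v \<bullet> x)) * (b * cos (w \<bullet> x)))
      = (\<lambda>x. a * b / 2 * sin ((v + w) \<bullet> x) + a * b / 2 * sin ((v - w) \<bullet> x))"
    by (simp add: fun_eq_iff sin_add sin_diff algebra_simps)
  then show ?case by (simp only: trig_poly.intros)
next
  case (sin b w)
  have "(\<lambda>x. (a * sin (v \<bullet> x)) * (b * sin (w \<bullet> x)))
      = (\<lambda>x. a * b / 2 * cos ((v - w) \<bullet> x) + (- (a * b / 2)) * cos ((v + w) \<bullet> x))"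
    by (simp add: fun_eq_iff cos_add cos_diff algebra_simps)
  then show ?case by (simp only: trig_poly.intros)
next
  case (add p q)
  then show ?case by (simp add: distrib_left trig_poly.add)
qed

lemma trig_poly_mult:
  assumes "trig_poly p" "trig_poly q" shows "trig_poly (\<lambda>x. p x * q x)"
  using assms
  by induction (auto simp: distrib_right intro: trig_poly_mult_cos trig_poly_mult_sin trig_poly.add)

lemma trig_poly_continuous: "trig_poly p \<Longrightarrow> continuous_on S p"
  by (induction rule: trig_poly.induct) (auto intro!: continuous_intros)

lemma trig_poly_separates:
  assumes "x \<noteq> y" shows "\<exists>p. trig_poly p \<and> p x \<noteq> p y"
proof -
  \<comment> \<open>Normalised so that the phases of \<open>x\<close> and \<open>y\<close> differ by
    exactly 1. Equal cosines and sines would force \<open>cos 1 = 1\<close>, against injectivity of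
    the cosine between 0 and \<open>pi\<close>.\<close>
  define v where "v = (x - y) /\<^sub>R (norm (x - y))\<^sup>2"
  have "v \<bullet> (x - y) = 1"
    using assms by (simp add: v_def power2_norm_eq_inner)
  then have d: "v \<bullet> x - v \<bullet> y = 1" by (simp add: inner_diff_right)
  have "\<not> (cos (v \<bullet> x) = cos (v \<bullet> y) \<and> sin (v \<bullet> x) = sin (v \<bullet> y))"
  proof
    assume eq: "cos (v \<bullet> x) = cos (v \<bullet> y) \<and> sin (v \<bullet> x) = sin (v \<bullet> y)"
    have "cos 1 = cos (v \<bullet> x - v \<bullet> y)" by (simp add: d)
    also have "\<dots> = 1" using eq by (simp add: cos_diff flip: power2_eq_square)
    finally have "cos 1 = cos (0::real)" by simp
    then show False using cos_inj_pi[of 1 0] pi_gt3 by simp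
  qed
  then consider "cos (v \<bullet> x) \<noteq> cos (v \<bullet> y)" | "sin (v \<bullet> x) \<noteq> sin (v \<bullet> y)" by blast
  then show ?thesis
    using trig_poly.cos[of 1 v] trig_poly.sin[of 1 v] by cases auto
qed

lemma trig_poly_dense:
  fixes f :: "'b::real_inner \<Rightarrow> real"
  assumes "compact K" "continuous_on K f" "0 < e"
  obtains p where "trig_poly p" "\<And>x. x \<in> K \<Longrightarrow> \<bar>f x - p x\<bar> < e"
proof -
  have "\<exists>p. trig_poly p \<and> (\<forall>x\<in>K. \<bar>f x - p x\<bar> < e)"
    by (rule Stone_Weierstrass_HOL[OF assms(1)])
      (use assms trig_poly_separates in \<open>auto intro: trig_poly_const trig_poly_continuous trig_poly_mult trig_poly.add\<close>)
  with that show thesis by blast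
qed

section \<open>Finite measures on a compact set are determined by trigonometric integrals\<close>

lemma integrable_continuous_on_compact:
  fixes f :: "'b::real_inner \<Rightarrow> real"
  assumes "finite_measure M" and sets: "sets M = sets borel" and K: "compact K" and AE: "AE x in M. x \<in> K"
    and f: "continuous_on UNIV f"
  shows "integrable M f"
proof -
  interpret finite_measure M by fact
  have "bounded (f ` K)"
    using f K by (intro compact_imp_bounded compact_continuous_image) (auto intro: continuous_on_subset)
  then obtain B where B: "\<And>x. x \<in> K \<Longrightarrow> norm (f x) \<le> B"
    by (auto simp: bounded_iff)
  have "f \<in> borel_measurable M"
    using borel_measurable_continuous_onI[OF f] sets by (simp cong: measurable_cong_sets)
  then show ?thesis
    using AE B by (intro integrable_const_bound[of _ B]) auto
qed

text \<open>Agreement passes from trigonometric polynomials to continuous functions by uniform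
  approximation on \<open>K\<close>, then to closed sets by dominated convergence. Closed sets form
  an intersection-stable generator of the Borel sets.\<close>

lemma measure_eqI_trig:
  fixes \<mu> \<nu> :: "'b::real_inner measure"
  assumes fin: "finite_measure \<mu>" "finite_measure \<nu>"
    and sets: "sets \<mu> = sets borel" "sets \<nu> = sets borel"
    and K: "compact K" "AE x in \<mu>. x \<in> K" "AE x in \<nu>. x \<in> K"
    and cos_eq: "\<And>v. (\<integral>x. cos (v \<bullet> x) \<partial>\<mu>) = (\<integral>x. cos (v \<bullet> x) \<partial>\<nu>)"
    and sin_eq: "\<And>v. (\<integral>x. sin (v \<bullet> x) \<partial>\<mu>) = (\<integral>x. sin (v \<bullet> x) \<partial>\<nu>)"
  shows "\<mu> = \<nu>"
proof -
  interpret \<mu>: finite_measure \<mu> by fact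
  interpret \<nu>: finite_measure \<nu> by fact
  note int = integrable_continuous_on_compact[OF fin(1) sets(1) K(1,2)]
    integrable_continuous_on_compact[OF fin(2) sets(2) K(1,3)]
  have trig: "(\<integral>x. p x \<partial>\<mu>) = (\<integral>x. p x \<partial>\<nu>)" if "trig_poly p" for p
    using that
  proof induction
    case (add p q)
    then show ?case by (simp add: int trig_poly_continuous)
  qed (simp_all add: cos_eq sin_eq)
  have cont: "(\<integral>x. f x \<partial>\<mu>) = (\<integral>x. f x \<partial>\<nu>)" if f: "continuous_on UNIV f" for f :: "'b \<Rightarrow> real"
  proof -
    define m where "m = measure \<mu> (space \<mu>) + measure \<nu> (space \<nu>)"
    \<comment> \<open>The summand 0 matches the shape of \<open>field_le_epsilon\<close>.\<close>
    have "\<bar>(\<integral>x. f x \<partial>\<mu>) - (\<integral>x. f x \<partial>\<nu>)\<bar> \<le> 0 + e" if e: "0 < e" for e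
    proof -
      have m: "0 \<le> m" by (simp add: m_def)
      \<comment> \<open>The two approximation errors add up to at most \<open>e' * m\<close>; the
        \<open>+ 1\<close> keeps the denominator positive when both measures are zero.\<close>
      define e' where "e' = e / (m + 1)"
      have e': "0 < e'" using e m by (simp add: e'_def)
      obtain p where p: "trig_poly p" "\<And>x. x \<in> K \<Longrightarrow> \<bar>f x - p x\<bar> < e'"
        using trig_poly_dense[OF K(1) continuous_on_subset[OF f] e'] by auto
      note pc = trig_poly_continuous[OF p(1), of UNIV]
      have "\<bar>(\<integral>x. f x \<partial>\<mu>) - (\<integral>x. p x \<partial>\<mu>)\<bar> \<le> e' * measure \<mu> (space \<mu>)"
      proof -
        have "\<bar>\<integral>x. f x - p x \<partial>\<mu>\<bar> \<le> (\<integral>x. \<bar>f x - p x\<bar> \<partial>\<mu>)"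
          by (rule integral_abs_bound)
        also have "\<dots> \<le> (\<integral>x. e' \<partial>\<mu>)"
          using K(2) p(2) by (intro integral_mono_AE) (auto simp: int f pc less_imp_le elim!: eventually_mono)
        finally show ?thesis by (simp add: int f pc mult.commute)
      qed
      moreover have "\<bar>(\<integral>x. f x \<partial>\<nu>) - (\<integral>x. p x \<partial>\<nu>)\<bar> \<le> e' * measure \<nu> (space \<nu>)"
      proof -
        have "\<bar>\<integral>x. f x - p x \<partial>\<nu>\<bar> \<le> (\<integral>x. \<bar>f x - p x\<bar> \<partial>\<nu>)"
          by (rule integral_abs_bound)
        also have "\<dots> \<le> (\<integral>x. e' \<partial>\<nu>)"
          using K(3) p(2) by (intro integral_mono_AE) (auto simp: int f pc less_imp_le elim!: eventually_mono)
        finally show ?thesis by (simp add: int f pc mult.commute)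
      qed
      ultimately have "\<bar>(\<integral>x. f x \<partial>\<mu>) - (\<integral>x. f x \<partial>\<nu>)\<bar> \<le> e' * m"
        using trig[OF p(1)] by (simp add: m_def distrib_left)
      also have "\<dots> \<le> e" using e m by (simp add: e'_def field_simps)
      finally show ?thesis by simp
    qed
    then have "\<bar>(\<integral>x. f x \<partial>\<mu>) - (\<integral>x. f x \<partial>\<nu>)\<bar> \<le> 0"
      by (rule field_le_epsilon)
    then show ?thesis by simp
  qed
  have [measurable_cong]: "sets \<mu> = sets borel" "sets \<nu> = sets borel" by fact+
  have "emeasure \<mu> C = emeasure \<nu> C" if C: "closed C" for C
  \<comment> \<open>\<open>infdist\<close> to the empty set is 0 by convention, so the approximating
    functions below would not tend to its indicator.\<close>
  proof (cases "C = {}")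
    case False
    have [measurable]: "C \<in> sets borel" using C by simp
    \<comment> \<open>Continuous functions equal to 1 on \<open>C\<close> and falling off with slope
      \<open>n\<close>; they decrease to the indicator because a point outside a closed set has
      positive distance from it.\<close>
    define f where "f n x = max 0 (1 - real n * infdist x C)" for n x
    have fc: "continuous_on UNIV (f n)" for n
      unfolding f_def by (intro continuous_intros)
    then have [measurable]: "f n \<in> borel_measurable borel" for n
      by (rule borel_measurable_continuous_onI)
    have lim: "(\<lambda>n. f n x) \<longlonglongrightarrow> indicator C x" for x
    proof (cases "x \<in> C")
      case True
      then show ?thesis by (simp add: f_def)
    next
      case out: False
      then have pos: "0 < infdist x C" using C False by (rule infdist_pos_not_in_closed[rotated 2])
      then obtain k :: nat where k: "1 < real k * infdist x C"
        using reals_Archimedean3 by blast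
      have "f n x = 0" if "n \<ge> k" for n
      proof -
        have "real k * infdist x C \<le> real n * infdist x C"
          using that pos by (intro mult_right_mono) auto
        with k show ?thesis by (simp add: f_def)
      qed
      then have "\<forall>\<^sub>F n in sequentially. f n x = indicator C x"
        using out by (auto simp: eventually_sequentially)
      then show ?thesis by (rule tendsto_eventually)
    qed
    have bd: "norm (f n x) \<le> 1" for n x
      by (auto simp: f_def infdist_nonneg)
    have "(\<lambda>n. \<integral>x. f n x \<partial>\<mu>) \<longlonglongrightarrow> (\<integral>x. indicator C x \<partial>\<mu>)"
      by (rule integral_dominated_convergence[where w = "\<lambda>_. 1"]) (use lim bd C in auto)
    moreover have "(\<lambda>n. \<integral>x. f n x \<partial>\<nu>) \<longlonglongrightarrow> (\<integral>x. indicator C x \<partial>\<nu>)"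
      by (rule integral_dominated_convergence[where w = "\<lambda>_. 1"]) (use lim bd C in auto)
    ultimately have "(\<integral>x. indicator C x \<partial>\<mu>) = (\<integral>x. indicator C x \<partial>\<nu> :: real)"
      using cont[OF fc] LIMSEQ_unique by fastforce
    then have "measure \<mu> C = measure \<nu> C"
      using sets C by simp
    then show ?thesis
      by (simp add: \<mu>.emeasure_eq_measure \<nu>.emeasure_eq_measure)
  qed simp
  then show "\<mu> = \<nu>"
    by (intro measure_eqI_generator_eq[where E = "Collect closed" and \<Omega> = UNIV and A = "\<lambda>_. UNIV"])
      (auto simp: Int_stable_def borel_eq_closed sets)
qed

section \<open>The symmetrized weighted law of a random vector\<close>

text \<open>The sum of the images of the weighted measure under \<open>\<Theta>\<close> and its
  negative. The sign is a second coordinate under counting measure, so the total mass is doubled and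
  factors 2 appear below.\<close>

definition symmetrized :: "'a measure \<Rightarrow> ('a \<Rightarrow> real) \<Rightarrow> ('a \<Rightarrow> 'b::euclidean_space) \<Rightarrow> 'b measure"
  where "symmetrized M W \<Theta> =
    distr (density (M \<Otimes>\<^sub>M count_space {1, -1::real}) (\<lambda>(x, s). ennreal (W x))) borel (\<lambda>(x, s). s *\<^sub>R \<Theta> x)"

lemma sets_symmetrized [simp, measurable_cong]: "sets (symmetrized M W \<Theta>) = sets borel"
  by (simp add: symmetrized_def)

lemma nn_integral_symmetrized:
  assumes [measurable]: "W \<in> borel_measurable M" "\<Theta> \<in> borel_measurable M" "f \<in> borel_measurable borel"
  shows "(\<integral>\<^sup>+z. f z \<partial>symmetrized M W \<Theta>) = (\<integral>\<^sup>+x. ennreal (W x) * (f (\<Theta> x) + f (- \<Theta> x)) \<partial>M)"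
proof -
  interpret S: sigma_finite_measure "count_space {1, -1::real}"
    by (rule sigma_finite_measure_count_space_finite) simp
  have [measurable]: "(\<lambda>(x, s). s *\<^sub>R \<Theta> x) \<in> M \<Otimes>\<^sub>M count_space {1, -1::real} \<rightarrow>\<^sub>M borel"
    unfolding case_prod_beta'
    by (intro borel_measurable_scaleR measurable_compose[OF measurable_snd] measurable_compose[OF measurable_fst]) auto
  have "(\<integral>\<^sup>+z. f z \<partial>symmetrized M W \<Theta>)
      = (\<integral>\<^sup>+p. ennreal (W (fst p)) * f (snd p *\<^sub>R \<Theta> (fst p)) \<partial>(M \<Otimes>\<^sub>M count_space {1, -1}))"
    by (simp add: symmetrized_def nn_integral_distr nn_integral_density case_prod_beta')
  also have "\<dots> = (\<integral>\<^sup>+x. \<integral>\<^sup>+s. ennreal (W x) * f (s *\<^sub>R \<Theta> x) \<partial>count_space {1, -1} \<partial>M)"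
    by (subst S.nn_integral_fst[symmetric]) auto
  also have "\<dots> = (\<integral>\<^sup>+x. ennreal (W x) * (f (\<Theta> x) + f (- \<Theta> x)) \<partial>M)"
    by (simp add: nn_integral_count_space_finite distrib_left)
  finally show ?thesis .
qed

text \<open>Symmetrization cancels the sine integrals and doubles the cosine integrals, so cosine
  data alone suffice for \<open>measure_eqI_trig\<close>.\<close>

lemma
  assumes W: "integrable M W" "\<And>x. 0 \<le> W x" and T: "\<Theta> \<in> borel_measurable M"
  shows finite_measure_symmetrized: "finite_measure (symmetrized M W \<Theta>)"
    and integral_cos_symmetrized:
      "(\<integral>z. cos (v \<bullet> z) \<partial>symmetrized M W \<Theta>) = 2 * (\<integral>x. W x * cos (v \<bullet> \<Theta> x) \<partial>M)"
    and integral_sin_symmetrized: "(\<integral>z. sin (v \<bullet> z) \<partial>symmetrized M W \<Theta>) = 0"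
    and AE_symmetrized:
      "K \<in> sets borel \<Longrightarrow> (\<And>x. \<Theta> x \<in> K) \<Longrightarrow> (\<And>x. - \<Theta> x \<in> K) \<Longrightarrow> AE z in symmetrized M W \<Theta>. z \<in> K"
proof -
  have Wm[measurable]: "W \<in> borel_measurable M" using W by auto
  note Tm[measurable] = T
  let ?\<nu> = "symmetrized M W \<Theta>"
  have sp: "space ?\<nu> = UNIV"
    using sets_eq_imp_space_eq[OF sets_symmetrized] by simp
  have "emeasure ?\<nu> UNIV = (\<integral>\<^sup>+x. ennreal (W x) * (1 + 1) \<partial>M)"
    using nn_integral_symmetrized[OF Wm T, of "\<lambda>_. 1"] by (simp add: sp)
  also have "\<dots> = ennreal (2 * (\<integral>x. W x \<partial>M))"
    using W by (simp add: nn_integral_multc nn_integral_eq_integral ennreal_mult' mult.commute)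
  finally have U: "emeasure ?\<nu> UNIV = ennreal (2 * (\<integral>x. W x \<partial>M))" .
  show fin: "finite_measure ?\<nu>"
    by (rule finite_measureI) (simp add: sp U)
  interpret \<nu>: finite_measure ?\<nu> by (rule fin)
  have mU: "measure ?\<nu> UNIV = 2 * (\<integral>x. W x \<partial>M)"
    using W by (simp add: measure_def U integral_nonneg)
  \<comment> \<open>\<open>nn_integral_symmetrized\<close> covers nonnegative integrands only, so it
    is applied to \<open>1 + h\<close>; the total mass
    \<open>2 * (\<integral>x. W x \<partial>M)\<close> is then subtracted.\<close>
  have shift: "(\<integral>z. h z \<partial>?\<nu>) = (\<integral>x. W x * (2 + h (\<Theta> x) + h (- \<Theta> x)) \<partial>M) - 2 * (\<integral>x. W x \<partial>M)"
    if h[measurable]: "h \<in> borel_measurable borel" and b: "\<And>z. \<bar>h z\<bar> \<le> 1" for h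
  proof -
    have nn: "0 \<le> 1 + h z" for z using b[of z] by (simp add: abs_le_iff)
    have "integrable ?\<nu> h"
      using b by (intro \<nu>.integrable_const_bound[of _ 1]) auto
    then have "(\<integral>z. h z \<partial>?\<nu>) = (\<integral>z. 1 + h z \<partial>?\<nu>) - measure ?\<nu> UNIV"
      by (simp add: sp)
    also have "(\<integral>z. 1 + h z \<partial>?\<nu>) = enn2real (\<integral>\<^sup>+z. ennreal (1 + h z) \<partial>?\<nu>)"
      using nn by (intro integral_eq_nn_integral) auto
    also have "(\<integral>\<^sup>+z. ennreal (1 + h z) \<partial>?\<nu>)
        = (\<integral>\<^sup>+x. ennreal (W x * (2 + h (\<Theta> x) + h (- \<Theta> x))) \<partial>M)"
    proof -
      have "ennreal (W x) * (ennreal (1 + h (\<Theta> x)) + ennreal (1 + h (- \<Theta> x)))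
          = ennreal (W x * (2 + h (\<Theta> x) + h (- \<Theta> x)))" for x
        using nn W(2) by (simp add: ennreal_mult' add_ac flip: ennreal_plus)
      then show ?thesis
        by (subst nn_integral_symmetrized) auto
    qed
    also have "enn2real \<dots> = (\<integral>x. W x * (2 + h (\<Theta> x) + h (- \<Theta> x)) \<partial>M)"
    proof (rule integral_eq_nn_integral[symmetric])
      have "0 \<le> W x * (2 + h (\<Theta> x) + h (- \<Theta> x))" for x
        using nn[of "\<Theta> x"] nn[of "- \<Theta> x"] W(2)[of x] by (intro mult_nonneg_nonneg) auto
      then show "AE x in M. 0 \<le> W x * (2 + h (\<Theta> x) + h (- \<Theta> x))" by simp
    qed simp
    finally show ?thesis by (simp add: mU)
  qed
  have ic: "integrable M (\<lambda>x. W x * cos (v \<bullet> \<Theta> x))"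
    by (rule Bochner_Integration.integrable_bound[OF W(1)]) (auto simp: abs_mult mult_left_le)
  have "(\<integral>z. cos (v \<bullet> z) \<partial>?\<nu>)
      = (\<integral>x. 2 * W x + 2 * (W x * cos (v \<bullet> \<Theta> x)) \<partial>M) - 2 * (\<integral>x. W x \<partial>M)"
    by (subst shift) (auto simp: algebra_simps)
  then show "(\<integral>z. cos (v \<bullet> z) \<partial>?\<nu>) = 2 * (\<integral>x. W x * cos (v \<bullet> \<Theta> x) \<partial>M)"
    using ic W by (simp add: Bochner_Integration.integral_add)
  \<comment> \<open>The two sine values in \<open>shift\<close> cancel, leaving twice the integral
    of \<open>W\<close> minus itself.\<close>
  show "(\<integral>z. sin (v \<bullet> z) \<partial>?\<nu>) = 0"
    by (subst shift) auto
  show "AE z in ?\<nu>. z \<in> K" if [measurable]: "K \<in> sets borel" and K: "\<And>x. \<Theta> x \<in> K" "\<And>x. - \<Theta> x \<in> K"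
  proof -
    have "(\<integral>\<^sup>+z. indicator (- K) z \<partial>?\<nu>) = 0"
      using K by (subst nn_integral_symmetrized) auto
    then have "AE z in ?\<nu>. indicator (- K) z = (0 :: ennreal)"
      by (subst (asm) nn_integral_0_iff_AE) auto
    then show ?thesis by (auto elim!: eventually_mono split: split_indicator_asm)
  qed
qed

section \<open>Even homogeneous functions and the equivalence\<close>

text \<open>Homogeneity lets the weight \<open>norm (X x)\<close> restore \<open>f (X x)\<close>
  from \<open>f (sgn (X x))\<close>; evenness makes the two signs contribute equally, whence the
  factor 2.\<close>

lemma nn_integral_symmetrized_even_homogeneous:
  fixes X :: "'a \<Rightarrow> real ^ 'n"
  assumes X: "integrable M X" and f: "f \<in> even_homogeneous"
  shows "(\<integral>\<^sup>+z. ennreal (f z) \<partial>symmetrized M (\<lambda>x. norm (X x)) (\<lambda>x. sgn (X x)))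
    = 2 * (\<integral>\<^sup>+x. ennreal (f (X x)) \<partial>M)"
proof -
  have [measurable]: "f \<in> borel_measurable borel" "X \<in> borel_measurable M"
    using f X by (auto simp: even_homogeneous_def)
  have "norm x * f (sgn x) = f (norm x *\<^sub>R sgn x)" for x
    using f by (simp add: even_homogeneous_def)
  also have "norm x *\<^sub>R sgn x = x" for x :: "real ^ 'n"
    by (cases "x = 0") (simp_all add: sgn_div_norm)
  finally have hom: "norm x * f (sgn x) = f x" for x .
  have weighted: "ennreal (norm x) * (ennreal (f (sgn x)) + ennreal (f (- sgn x))) = 2 * ennreal (f x)" for x
  proof -
    have "ennreal (norm x) * (ennreal (f (sgn x)) + ennreal (f (- sgn x)))
        = 2 * ennreal (norm x * f (sgn x))"
      using f by (simp add: even_homogeneous_def ennreal_mult' mult_2 distrib_left)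
    then show ?thesis by (simp only: hom)
  qed
  have "(\<integral>\<^sup>+z. ennreal (f z) \<partial>symmetrized M (\<lambda>x. norm (X x)) (\<lambda>x. sgn (X x)))
      = (\<integral>\<^sup>+x. 2 * ennreal (f (X x)) \<partial>M)"
    unfolding weighted[symmetric] by (rule nn_integral_symmetrized) measurable
  also have "\<dots> = 2 * (\<integral>\<^sup>+x. ennreal (f (X x)) \<partial>M)"
    by (rule nn_integral_cmult) measurable
  finally show ?thesis .
qed

theorem theorem2:
  fixes M :: "'a measure" and N :: "'b measure"
    and X :: "'a \<Rightarrow> real ^ 'n" and Y :: "'b \<Rightarrow> real ^ 'n"
  assumes "prob_space M" and "prob_space N"
    and "integrable M X" and "integrable N Y"
    and "\<not> (AE \<omega> in M. X \<omega> = 0)" and "\<not> (AE \<omega> in N. Y \<omega> = 0)"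
  shows "zonoid_equivalent M X N Y \<longleftrightarrow>
    (\<forall>f\<in>even_homogeneous. (\<integral>\<^sup>+\<omega>. ennreal (f (X \<omega>)) \<partial>M) = (\<integral>\<^sup>+\<omega>. ennreal (f (Y \<omega>)) \<partial>N))"
proof
  have Xm[measurable]: "X \<in> borel_measurable M" and Ym[measurable]: "Y \<in> borel_measurable N"
    using assms by auto
  let ?\<mu> = "symmetrized M (\<lambda>x. norm (X x)) (\<lambda>x. sgn (X x))"
  let ?\<nu> = "symmetrized N (\<lambda>y. norm (Y y)) (\<lambda>y. sgn (Y y))"
  assume "zonoid_equivalent M X N Y"
  then have abs_eq: "(\<integral>x. \<bar>u \<bullet> X x\<bar> \<partial>M) = (\<integral>y. \<bar>u \<bullet> Y y\<bar> \<partial>N)" for u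
    by (simp add: zonoid_equivalent_def)
  have cos_eq: "(\<integral>x. norm (X x) * cos (v \<bullet> sgn (X x)) \<partial>M) = (\<integral>y. norm (Y y) * cos (v \<bullet> sgn (Y y)) \<partial>N)" for v
    by (rule integral_cos_sgn_eq[OF assms(1-4) abs_eq])
  have sgn_bound: "norm (sgn x) \<le> 1" for x :: "real ^ 'n"
    by (simp add: norm_sgn)
  have X: "integrable M (\<lambda>x. norm (X x))" "\<And>x. 0 \<le> norm (X x)" "(\<lambda>x. sgn (X x)) \<in> borel_measurable M"
    and Y: "integrable N (\<lambda>y. norm (Y y))" "\<And>y. 0 \<le> norm (Y y)" "(\<lambda>y. sgn (Y y)) \<in> borel_measurable N"
    using assms by auto
  have "?\<mu> = ?\<nu>"
  \<comment> \<open>The ball rather than the sphere, because \<open>sgn 0 = 0\<close>.\<close>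
  proof (rule measure_eqI_trig[where K = "cball 0 1"])
    show "finite_measure ?\<mu>" "finite_measure ?\<nu>"
      by (rule finite_measure_symmetrized[OF X] finite_measure_symmetrized[OF Y])+
    show "AE z in ?\<mu>. z \<in> cball 0 1"
      by (rule AE_symmetrized[OF X]) (auto simp: sgn_bound)
    show "AE z in ?\<nu>. z \<in> cball 0 1"
      by (rule AE_symmetrized[OF Y]) (auto simp: sgn_bound)
    show "(\<integral>z. cos (v \<bullet> z) \<partial>?\<mu>) = (\<integral>z. cos (v \<bullet> z) \<partial>?\<nu>)" for v
      unfolding integral_cos_symmetrized[OF X] integral_cos_symmetrized[OF Y] cos_eq ..
    show "(\<integral>z. sin (v \<bullet> z) \<partial>?\<mu>) = (\<integral>z. sin (v \<bullet> z) \<partial>?\<nu>)" for v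
      unfolding integral_sin_symmetrized[OF X] integral_sin_symmetrized[OF Y] ..
  qed simp_all
  show "\<forall>f\<in>even_homogeneous. (\<integral>\<^sup>+\<omega>. ennreal (f (X \<omega>)) \<partial>M) = (\<integral>\<^sup>+\<omega>. ennreal (f (Y \<omega>)) \<partial>N)"
  proof
    fix f :: "real ^ 'n \<Rightarrow> real" assume f: "f \<in> even_homogeneous"
    have "2 * (\<integral>\<^sup>+\<omega>. ennreal (f (X \<omega>)) \<partial>M) = 2 * (\<integral>\<^sup>+\<omega>. ennreal (f (Y \<omega>)) \<partial>N)"
      unfolding nn_integral_symmetrized_even_homogeneous[OF assms(3) f, symmetric]
        nn_integral_symmetrized_even_homogeneous[OF assms(4) f, symmetric] \<open>?\<mu> = ?\<nu>\<close> ..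
    \<comment> \<open>Cancellation is valid even for infinite expectations, as 2 is neither 0 nor
      infinite.\<close>
    then show "(\<integral>\<^sup>+\<omega>. ennreal (f (X \<omega>)) \<partial>M) = (\<integral>\<^sup>+\<omega>. ennreal (f (Y \<omega>)) \<partial>N)"
      by (simp add: ennreal_mult_cancel_left)
  qed
next
  have [measurable]: "X \<in> borel_measurable M" "Y \<in> borel_measurable N"
    using assms by auto
  assume eq: "\<forall>f\<in>even_homogeneous. (\<integral>\<^sup>+\<omega>. ennreal (f (X \<omega>)) \<partial>M) = (\<integral>\<^sup>+\<omega>. ennreal (f (Y \<omega>)) \<partial>N)"
  \<comment> \<open>For the converse, the functions that define the zonoid are themselves test
    functions.\<close>
  have even_hom: "(\<lambda>x. \<bar>u \<bullet> x\<bar>) \<in> even_homogeneous" for u :: "real ^ 'n"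
    by (auto simp: even_homogeneous_def abs_mult)
  have "(\<integral>\<^sup>+\<omega>. ennreal \<bar>u \<bullet> X \<omega>\<bar> \<partial>M) = (\<integral>\<^sup>+\<omega>. ennreal \<bar>u \<bullet> Y \<omega>\<bar> \<partial>N)" for u
    using bspec[OF eq even_hom] .
  then show "zonoid_equivalent M X N Y"
    unfolding zonoid_equivalent_def by (subst (1 2) integral_eq_nn_integral) auto
qed

end
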